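(* For any 3-tensor $t$ over $\mathbb{F}$ not of the form $x\otimes y\otimes z$, $$\omega(\langle2\rangle,t)\,\omega_{\mathrm{M}}(t,\langle2,2,2\rangle)\geq 2\,\mathrm{irr}_{\mathrm{M}}(t).$$
   Context: All tensors are 3-tensors over a fixed field $\mathbb{F}$, not of the form $x\otimes y\otimes z$. For $t \in \mathbb{F}^{n_1}\otimes\mathbb{F}^{n_2}\otimes\mathbb{F}^{n_3}$, $s\in \mathbb{F}^{m_1}\otimes\mathbb{F}^{m_2}\otimes\mathbb{F}^{m_3}$ write $t\geq s$ if there are linear maps $A_i:\mathbb{F}^{n_i}\to\mathbb{F}^{m_i}$ with $(A_1\otimes A_2\otimes A_3)t=s$, and $t\geq_{\mathrm{M}} s$ if such maps exist whose matrices in the standard bases are generalised sub-permutation matrices (at most one nonzero entry in each row and column). Tensor powers are regarded as 3-tensors by grouping factors. $\omega(t,s):=\lim_{n\to\infty}\frac1n\min\{m: t^{\otimes m}\geq s^{\otimes n}\}$ and $\omega_{\mathrm{M}}(t,s)$ is the same with $\geq_{\mathrm{M}}$ in place of $\geq$. $\langle n\rangle:=\sum_{i=1}^n e_i\otimes e_i\otimes e_i$. Monomial irreversibility: $\mathrm{irr}_{\mathrm{M}}(t):=\omega(\langle2\rangle,t)\,\omega_{\mathrm{M}}(t,\langle2\rangle)$. Matrix multiplication tensor: $\langle a,b,c\rangle:=\sum_{i=1}^a\sum_{j=1}^b\sum_{k=1}^c e_{(i,j)}\otimes e_{(j,k)}\otimes e_{(k,i)}$. *)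

theory Defs
  imports "HOL-Analysis.Analysis"
begin

text \<open>
  An element of the tensor product of the coordinate spaces over the finite sets \<open>I\<close>, \<open>J\<close>, \<open>K\<close>
  is given by its coefficients in the standard bases. The space \<open>\<F>^n\<close> is the case of an index set
  with \<open>n\<close> elements. Values of \<open>coeff\<close> outside the index sets are irrelevant.
\<close>

record ('i, 'j, 'k, 'a) tensor3 =
  idx1 :: "'i set"
  idx2 :: "'j set"
  idx3 :: "'k set"
  coeff :: "'i \<Rightarrow> 'j \<Rightarrow> 'k \<Rightarrow> 'a"

definition is_simple :: "('i, 'j, 'k, 'a::field) tensor3 \<Rightarrow> bool" where
  "is_simple t \<longleftrightarrow> (\<exists>x y z. \<forall>i\<in>idx1 t. \<forall>j\<in>idx2 t. \<forall>k\<in>idx3 t.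
     coeff t i j k = x i * y j * z k)"

text \<open>
  A linear map between coordinate spaces is given by its matrix: \<open>A p i\<close> is the entry in row \<open>p\<close>
  (codomain) and column \<open>i\<close> (domain). The coefficients of \<open>(A \<otimes> B \<otimes> C) t\<close> follow by expanding
  \<open>(A \<otimes> B \<otimes> C) (e\<^sub>i \<otimes> e\<^sub>j \<otimes> e\<^sub>k) = A e\<^sub>i \<otimes> B e\<^sub>j \<otimes> C e\<^sub>k\<close>.
\<close>

definition apply_maps ::
  "('p \<Rightarrow> 'i \<Rightarrow> 'a) \<Rightarrow> ('q \<Rightarrow> 'j \<Rightarrow> 'a) \<Rightarrow> ('r \<Rightarrow> 'k \<Rightarrow> 'a) \<Rightarrow>
   ('i, 'j, 'k, 'a::field) tensor3 \<Rightarrow> 'p \<Rightarrow> 'q \<Rightarrow> 'r \<Rightarrow> 'a" where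
  "apply_maps A B C t p q r =
     (\<Sum>i\<in>idx1 t. \<Sum>j\<in>idx2 t. \<Sum>k\<in>idx3 t. A p i * B q j * C r k * coeff t i j k)"

definition maps_to ::
  "('p \<Rightarrow> 'i \<Rightarrow> 'a) \<Rightarrow> ('q \<Rightarrow> 'j \<Rightarrow> 'a) \<Rightarrow> ('r \<Rightarrow> 'k \<Rightarrow> 'a) \<Rightarrow>
   ('i, 'j, 'k, 'a::field) tensor3 \<Rightarrow> ('p, 'q, 'r, 'a) tensor3 \<Rightarrow> bool" where
  "maps_to A B C t s \<longleftrightarrow> (\<forall>p\<in>idx1 s. \<forall>q\<in>idx2 s. \<forall>r\<in>idx3 s.
     apply_maps A B C t p q r = coeff s p q r)"

definition restricts ::
  "('i, 'j, 'k, 'a::field) tensor3 \<Rightarrow> ('p, 'q, 'r, 'a) tensor3 \<Rightarrow> bool" where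
  "restricts t s \<longleftrightarrow> (\<exists>A B C. maps_to A B C t s)"

definition gen_sub_permutation :: "'p set \<Rightarrow> 'i set \<Rightarrow> ('p \<Rightarrow> 'i \<Rightarrow> 'a::field) \<Rightarrow> bool" where
  "gen_sub_permutation P I A \<longleftrightarrow>
     (\<forall>p\<in>P. \<exists>\<^sub>\<le>\<^sub>1 i. i \<in> I \<and> A p i \<noteq> 0) \<and>
     (\<forall>i\<in>I. \<exists>\<^sub>\<le>\<^sub>1 p. p \<in> P \<and> A p i \<noteq> 0)"

definition mon_restricts ::
  "('i, 'j, 'k, 'a::field) tensor3 \<Rightarrow> ('p, 'q, 'r, 'a) tensor3 \<Rightarrow> bool" where
  "mon_restricts t s \<longleftrightarrow> (\<exists>A B C.
     gen_sub_permutation (idx1 s) (idx1 t) A \<and>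
     gen_sub_permutation (idx2 s) (idx2 t) B \<and>
     gen_sub_permutation (idx3 s) (idx3 t) C \<and>
     maps_to A B C t s)"

text \<open>
  Grouping the factors of the \<open>m\<close>-fold tensor power, the standard basis of the \<open>m\<close>-th power of the
  coordinate space over \<open>I\<close> is indexed by the lists of length \<open>m\<close> over \<open>I\<close>.
\<close>

definition tensor_power ::
  "('i, 'j, 'k, 'a::field) tensor3 \<Rightarrow> nat \<Rightarrow> ('i list, 'j list, 'k list, 'a) tensor3" where
  "tensor_power t m =
     \<lparr> idx1 = {is. set is \<subseteq> idx1 t \<and> length is = m},
       idx2 = {js. set js \<subseteq> idx2 t \<and> length js = m},
       idx3 = {ks. set ks \<subseteq> idx3 t \<and> length ks = m},
       coeff = (\<lambda>is js ks. \<Prod>l<m. coeff t (is ! l) (js ! l) (ks ! l)) \<rparr>"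

text \<open>
  The minimum over \<open>m\<close> is taken in the extended reals, so that it is \<open>\<infinity>\<close> if no power of \<open>t\<close>
  restricts to the \<open>n\<close>-th power of \<open>s\<close>. This happens for instance if \<open>s\<close> is the unit tensor of
  size 2 and \<open>t = x \<otimes> u\<close> with \<open>u\<close> a matrix. The division by \<open>0\<close> in the term for \<open>n = 0\<close> does not
  influence the limit.
\<close>

definition omega ::
  "('i, 'j, 'k, 'a::field) tensor3 \<Rightarrow> ('p, 'q, 'r, 'a) tensor3 \<Rightarrow> ennreal" where
  "omega t s = lim (\<lambda>n.
     (INF m\<in>{m. restricts (tensor_power t m) (tensor_power s n)}. of_nat m) / of_nat n)"

definition omega_mon ::
  "('i, 'j, 'k, 'a::field) tensor3 \<Rightarrow> ('p, 'q, 'r, 'a) tensor3 \<Rightarrow> ennreal" where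
  "omega_mon t s = lim (\<lambda>n.
     (INF m\<in>{m. mon_restricts (tensor_power t m) (tensor_power s n)}. of_nat m) / of_nat n)"

definition std_basis :: "'i \<Rightarrow> 'i \<Rightarrow> 'a::field" where
  "std_basis i = (\<lambda>p. if p = i then 1 else 0)"

definition unit_tensor :: "nat \<Rightarrow> (nat, nat, nat, 'a::field) tensor3" where
  "unit_tensor n =
     \<lparr> idx1 = {1..n}, idx2 = {1..n}, idx3 = {1..n},
       coeff = (\<lambda>p q r. \<Sum>i=1..n. std_basis i p * std_basis i q * std_basis i r) \<rparr>"

definition matmul_tensor ::
  "nat \<Rightarrow> nat \<Rightarrow> nat \<Rightarrow> (nat \<times> nat, nat \<times> nat, nat \<times> nat, 'a::field) tensor3" where
  "matmul_tensor a b c =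
     \<lparr> idx1 = {1..a} \<times> {1..b}, idx2 = {1..b} \<times> {1..c}, idx3 = {1..c} \<times> {1..a},
       coeff = (\<lambda>p q r. \<Sum>i=1..a. \<Sum>j=1..b. \<Sum>k=1..c.
         std_basis (i, j) p * std_basis (j, k) q * std_basis (k, i) r) \<rparr>"

definition irr_mon :: "('i, 'j, 'k, 'a::field) tensor3 \<Rightarrow> ennreal" where
  "irr_mon t = omega (unit_tensor 2 :: (nat, nat, nat, 'a) tensor3) t *
     omega_mon t (unit_tensor 2 :: (nat, nat, nat, 'a) tensor3)"

end

theory Submission
  imports Defs "HOL-Real_Asymp.Real_Asymp"
begin

text \<open>
  It suffices to show \<open>2 omega_mon t <2> \<le> omega_mon t <2,2,2>\<close>. The support of the matrix
  multiplication tensor \<open><q,q,q>\<close> consists of the triangles of a complete tripartite graph whose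
  edges are the basis vectors, so a family of edge-disjoint triangles whose edges form no other
  triangle yields a unit tensor by restriction to these edges. The Ruzsa--Szemeredi construction
  gives such a family of size \<open>q^(2 - o(1))\<close>; the \<open>N\<close>-th power of \<open><2,2,2>\<close> therefore restricts
  monomially to the power of \<open><2>\<close> with exponent \<open>(2 - o(1)) N\<close>.
  Since the costs are subadditive, Fekete's lemma provides the limits.
\<close>

section \<open>Monomial restrictions: embeddings, composition, tensor products\<close>

text \<open>Zero-one matrices selecting the coordinates \<open>\<alpha> p\<close>,
  \<open>\<beta> q\<close>, \<open>\<gamma> r\<close> do this: rows have at most one nonzero entry
  by construction, columns by injectivity. All concrete restrictions below are built this
  way.\<close>

lemma mon_restricts_embedding:
  fixes t :: "('i, 'j, 'k, 'a::field) tensor3" and s :: "('p, 'q, 'r, 'a) tensor3"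
  assumes fin: "finite (idx1 t)" "finite (idx2 t)" "finite (idx3 t)"
    and inj: "inj_on \<alpha> (idx1 s)" "inj_on \<beta> (idx2 s)" "inj_on \<gamma> (idx3 s)"
    and im: "\<alpha> ` idx1 s \<subseteq> idx1 t" "\<beta> ` idx2 s \<subseteq> idx2 t" "\<gamma> ` idx3 s \<subseteq> idx3 t"
    and coeff: "\<And>p q r. p \<in> idx1 s \<Longrightarrow> q \<in> idx2 s \<Longrightarrow> r \<in> idx3 s \<Longrightarrow>
      coeff t (\<alpha> p) (\<beta> q) (\<gamma> r) = coeff s p q r"
  shows "mon_restricts t s"
proof -
  define A :: "'p \<Rightarrow> 'i \<Rightarrow> 'a" where "A = (\<lambda>p i. if i = \<alpha> p then 1 else 0)"
  define B :: "'q \<Rightarrow> 'j \<Rightarrow> 'a" where "B = (\<lambda>p i. if i = \<beta> p then 1 else 0)"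
  define C :: "'r \<Rightarrow> 'k \<Rightarrow> 'a" where "C = (\<lambda>p i. if i = \<gamma> p then 1 else 0)"
  have "gen_sub_permutation (idx1 s) (idx1 t) A" "gen_sub_permutation (idx2 s) (idx2 t) B"
    "gen_sub_permutation (idx3 s) (idx3 t) C"
    using inj by (auto simp: gen_sub_permutation_def A_def B_def C_def Uniq_def inj_on_def)
  moreover have "maps_to A B C t s"
    unfolding maps_to_def
  proof (intro ballI)
    fix p q r assume pqr: "p \<in> idx1 s" "q \<in> idx2 s" "r \<in> idx3 s"
    have "apply_maps A B C t p q r =
      (\<Sum>i\<in>idx1 t. if i = \<alpha> p then \<Sum>j\<in>idx2 t. if j = \<beta> q then
        \<Sum>k\<in>idx3 t. if k = \<gamma> r then coeff t i j k else 0 else 0 else 0)"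
      unfolding apply_maps_def A_def B_def C_def by (auto intro!: sum.cong)
    also have "\<dots> = coeff t (\<alpha> p) (\<beta> q) (\<gamma> r)"
      using fin im pqr by (simp add: image_subset_iff)
    finally show "apply_maps A B C t p q r = coeff s p q r" using coeff pqr by simp
  qed
  ultimately show ?thesis unfolding mon_restricts_def by blast
qed

lemma apply_maps_conv_triples:
  "apply_maps A B C t p q r =
    (\<Sum>(i, j, k)\<in>idx1 t \<times> idx2 t \<times> idx3 t. A p i * B q j * C r k * coeff t i j k)"
  unfolding apply_maps_def by (simp add: sum.cartesian_product)

text \<open>A nonzero entry of the product needs some \<open>x\<close> at which both factors are
  nonzero; the two uniqueness conditions are then chained through \<open>x\<close>.\<close>

lemma gen_sub_permutation_compose:
  assumes "gen_sub_permutation P X A'" "gen_sub_permutation X I A"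
  shows "gen_sub_permutation P I (\<lambda>p i. \<Sum>x\<in>X. A' p x * A x i)"
proof -
  let ?M = "\<lambda>p i. \<Sum>x\<in>X. A' p x * A x i"
  have nz: "\<exists>x\<in>X. A' p x \<noteq> 0 \<and> A x i \<noteq> 0" if "?M p i \<noteq> 0" for p i
    using that by (metis (mono_tags, lifting) mult_eq_0_iff sum.neutral)
  note uniq = assms[unfolded gen_sub_permutation_def Uniq_def]
  show ?thesis
    unfolding gen_sub_permutation_def
  proof (intro conjI ballI Uniq_I; elim conjE)
    fix p i j assume *: "p \<in> P" "i \<in> I" "?M p i \<noteq> 0" "j \<in> I" "?M p j \<noteq> 0"
    obtain x where x: "x \<in> X" "A' p x \<noteq> 0" "A x i \<noteq> 0" using nz *(3) by blast
    obtain y where y: "y \<in> X" "A' p y \<noteq> 0" "A y j \<noteq> 0" using nz *(5) by blast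
    have "x = y" using uniq(1) \<open>p \<in> P\<close> x y by blast
    then show "i = j" using uniq(2) * x y by blast
  next
    fix i p q assume *: "i \<in> I" "p \<in> P" "?M p i \<noteq> 0" "q \<in> P" "?M q i \<noteq> 0"
    obtain x where x: "x \<in> X" "A' p x \<noteq> 0" "A x i \<noteq> 0" using nz *(3) by blast
    obtain y where y: "y \<in> X" "A' q y \<noteq> 0" "A y i \<noteq> 0" using nz *(5) by blast
    have "x = y" using uniq(2) \<open>i \<in> I\<close> x y by blast
    then show "p = q" using uniq(1) * x y by blast
  qed
qed

lemma sum_product3:
  fixes f :: "'x \<Rightarrow> 'a::comm_semiring_0"
  shows "(\<Sum>x\<in>X. f x) * (\<Sum>y\<in>Y. g y) * (\<Sum>z\<in>Z. h z) =
    (\<Sum>(x, y, z)\<in>X \<times> Y \<times> Z. f x * g y * h z)"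
  by (simp add: mult.assoc
      flip: sum.cartesian_product sum_distrib_left sum_distrib_right)

lemma mon_restricts_trans:
  fixes t :: "('i, 'j, 'k, 'a::field) tensor3" and s :: "('p, 'q, 'r, 'a) tensor3"
    and u :: "('x, 'y, 'z, 'a) tensor3"
  assumes "mon_restricts t s" "mon_restricts s u"
  shows "mon_restricts t u"
proof -
  obtain A B C where gen: "gen_sub_permutation (idx1 s) (idx1 t) A"
    "gen_sub_permutation (idx2 s) (idx2 t) B" "gen_sub_permutation (idx3 s) (idx3 t) C"
    and ts: "maps_to A B C t s"
    using assms(1) unfolding mon_restricts_def by blast
  obtain A' B' C' where gen': "gen_sub_permutation (idx1 u) (idx1 s) A'"
    "gen_sub_permutation (idx2 u) (idx2 s) B'" "gen_sub_permutation (idx3 u) (idx3 s) C'"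
    and su: "maps_to A' B' C' s u"
    using assms(2) unfolding mon_restricts_def by blast
  let ?A = "\<lambda>p i. \<Sum>x\<in>idx1 s. A' p x * A x i"
  let ?B = "\<lambda>p i. \<Sum>x\<in>idx2 s. B' p x * B x i"
  let ?C = "\<lambda>p i. \<Sum>x\<in>idx3 s. C' p x * C x i"
  let ?S = "idx1 s \<times> idx2 s \<times> idx3 s" and ?T = "idx1 t \<times> idx2 t \<times> idx3 t"
  have "maps_to ?A ?B ?C t u"
    unfolding maps_to_def
  proof (intro ballI)
    fix p q r assume pqr: "p \<in> idx1 u" "q \<in> idx2 u" "r \<in> idx3 u"
    \<comment> \<open>As a single sum over intermediate triples, this product turns the composition
      into a double sum over \<open>?S\<close> and \<open>?T\<close> that can be
      interchanged.\<close>
    have prod: "?A p i * ?B q j * ?C r k =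
        (\<Sum>(x, y, z)\<in>?S. A' p x * B' q y * C' r z * (A x i * B y j * C z k))" for i j k
      unfolding sum_product3 by (intro sum.cong refl) (auto simp: mult_ac)
    have "coeff u p q r = apply_maps A' B' C' s p q r"
      using su pqr by (simp add: maps_to_def)
    also have "\<dots> = (\<Sum>(x, y, z)\<in>?S. A' p x * B' q y * C' r z * apply_maps A B C t x y z)"
      using ts unfolding apply_maps_conv_triples[of A' B' C'] maps_to_def
      by (intro sum.cong refl) auto
    also have "\<dots> = (\<Sum>(x, y, z)\<in>?S. \<Sum>(i, j, k)\<in>?T.
        A' p x * B' q y * C' r z * (A x i * B y j * C z k) * coeff t i j k)"
      unfolding apply_maps_conv_triples
      by (intro sum.cong refl) (auto simp: sum_distrib_left mult_ac intro!: sum.cong)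
    also have "\<dots> = (\<Sum>(i, j, k)\<in>?T. \<Sum>(x, y, z)\<in>?S.
        A' p x * B' q y * C' r z * (A x i * B y j * C z k) * coeff t i j k)"
      unfolding case_prod_unfold by (rule sum.swap)
    also have "\<dots> = apply_maps ?A ?B ?C t p q r"
      unfolding apply_maps_conv_triples prod
      by (intro sum.cong refl) (auto simp: sum_distrib_right case_prod_unfold)
    finally show "apply_maps ?A ?B ?C t p q r = coeff u p q r" by simp
  qed
  then show ?thesis
    unfolding mon_restricts_def
    using gen_sub_permutation_compose[OF gen'(1) gen(1)]
      gen_sub_permutation_compose[OF gen'(2) gen(2)] gen_sub_permutation_compose[OF gen'(3) gen(3)]
    by (intro exI[of _ ?A] exI[of _ ?B] exI[of _ ?C] conjI)
qed

lemma idx_tensor_power [simp]: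
  "idx1 (tensor_power t m) = {is. set is \<subseteq> idx1 t \<and> length is = m}"
  "idx2 (tensor_power t m) = {is. set is \<subseteq> idx2 t \<and> length is = m}"
  "idx3 (tensor_power t m) = {is. set is \<subseteq> idx3 t \<and> length is = m}"
  by (simp_all add: tensor_power_def)

lemma coeff_tensor_power:
  "coeff (tensor_power t m) is js ks = (\<Prod>l<m. coeff t (is ! l) (js ! l) (ks ! l))"
  by (simp add: tensor_power_def)

lemma prod_lessThan_add:
  fixes f :: "nat \<Rightarrow> 'a::comm_monoid_mult"
  shows "(\<Prod>l<m + n. f l) = (\<Prod>l<m. f l) * (\<Prod>l<n. f (m + l))"
  by (induction n) (simp_all add: mult.assoc)

lemma coeff_tensor_power_append:
  assumes "length is = m" "length js = m" "length ks = m"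
  shows "coeff (tensor_power t (m + m')) (is @ is') (js @ js') (ks @ ks') =
    coeff (tensor_power t m) is js ks * coeff (tensor_power t m') is' js' ks'"
  using assms by (simp add: coeff_tensor_power prod_lessThan_add nth_append)

text \<open>This is a Kronecker product on words, cut after \<open>n\<close> letters in the codomain
  and after \<open>m\<close> in the domain. At a nonzero entry both factors are nonzero, so each
  half determines its counterpart.\<close>

lemma gen_sub_permutation_append:
  assumes "gen_sub_permutation {p. set p \<subseteq> P \<and> length p = n} {i. set i \<subseteq> I \<and> length i = m} A"
    and "gen_sub_permutation {p. set p \<subseteq> P \<and> length p = n'} {i. set i \<subseteq> I \<and> length i = m'} A'"
  shows "gen_sub_permutation {p. set p \<subseteq> P \<and> length p = n + n'}
    {i. set i \<subseteq> I \<and> length i = m + m'}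
    (\<lambda>p i. A (take n p) (take m i) * A' (drop n p) (drop m i))"
proof -
  have split: "set (take k x) \<subseteq> X \<and> length (take k x) = k \<and> set (drop k x) \<subseteq> X \<and> length (drop k x) = k'"
    if "set x \<subseteq> X" "length x = k + k'" for x :: "'z list" and X k k'
    using that set_take_subset[of k x] set_drop_subset[of k x] by auto
  have eq: "x = y" if "take k x = take k y" "drop k x = drop k y" for x y :: "'z list" and k
    using that by (metis append_take_drop_id)
  show ?thesis
    unfolding gen_sub_permutation_def
  proof (intro conjI ballI Uniq_I; clarsimp)
    fix p i j
    assume *: "set p \<subseteq> P" "length p = n + n'" "set i \<subseteq> I" "length i = m + m'"
      "set j \<subseteq> I" "length j = m + m'"
      "A (take n p) (take m i) \<noteq> 0" "A' (drop n p) (drop m i) \<noteq> 0"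
      "A (take n p) (take m j) \<noteq> 0" "A' (drop n p) (drop m j) \<noteq> 0"
    show "i = j"
    proof (rule eq)
      show "take m i = take m j"
        using assms(1) split[OF *(1,2)] split[OF *(3,4)] split[OF *(5,6)] *(7-)
        unfolding gen_sub_permutation_def Uniq_def by blast
      show "drop m i = drop m j"
        using assms(2) split[OF *(1,2)] split[OF *(3,4)] split[OF *(5,6)] *(7-)
        unfolding gen_sub_permutation_def Uniq_def by blast
    qed
  next
    fix i p q
    assume *: "set i \<subseteq> I" "length i = m + m'" "set p \<subseteq> P" "length p = n + n'"
      "set q \<subseteq> P" "length q = n + n'"
      "A (take n p) (take m i) \<noteq> 0" "A' (drop n p) (drop m i) \<noteq> 0"
      "A (take n q) (take m i) \<noteq> 0" "A' (drop n q) (drop m i) \<noteq> 0"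
    show "p = q"
    proof (rule eq)
      show "take n p = take n q"
        using assms(1) split[OF *(1,2)] split[OF *(3,4)] split[OF *(5,6)] *(7-)
        unfolding gen_sub_permutation_def Uniq_def by blast
      show "drop n p = drop n q"
        using assms(2) split[OF *(1,2)] split[OF *(3,4)] split[OF *(5,6)] *(7-)
        unfolding gen_sub_permutation_def Uniq_def by blast
    qed
  qed
qed

text \<open>The tensor product of two restrictions; it makes the cost subadditive in the exponent of
  \<open>s\<close>.\<close>

lemma mon_restricts_tensor_power_add:
  fixes t :: "('i, 'j, 'k, 'a::field) tensor3" and s :: "('p, 'q, 'r, 'a) tensor3"
  assumes "mon_restricts (tensor_power t m) (tensor_power s n)"
    and "mon_restricts (tensor_power t m') (tensor_power s n')"
  shows "mon_restricts (tensor_power t (m + m')) (tensor_power s (n + n'))"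
proof -
  let ?tm = "tensor_power t m" and ?sn = "tensor_power s n"
  let ?tm' = "tensor_power t m'" and ?sn' = "tensor_power s n'"
  let ?tmm = "tensor_power t (m + m')"
  obtain A B C where gen: "gen_sub_permutation (idx1 ?sn) (idx1 ?tm) A"
    "gen_sub_permutation (idx2 ?sn) (idx2 ?tm) B" "gen_sub_permutation (idx3 ?sn) (idx3 ?tm) C"
    and ts: "maps_to A B C ?tm ?sn"
    using assms(1) unfolding mon_restricts_def by blast
  obtain A' B' C' where gen': "gen_sub_permutation (idx1 ?sn') (idx1 ?tm') A'"
    "gen_sub_permutation (idx2 ?sn') (idx2 ?tm') B'" "gen_sub_permutation (idx3 ?sn') (idx3 ?tm') C'"
    and ts': "maps_to A' B' C' ?tm' ?sn'"
    using assms(2) unfolding mon_restricts_def by blast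
  let ?A = "\<lambda>p i. A (take n p) (take m i) * A' (drop n p) (drop m i)"
  let ?B = "\<lambda>p i. B (take n p) (take m i) * B' (drop n p) (drop m i)"
  let ?C = "\<lambda>p i. C (take n p) (take m i) * C' (drop n p) (drop m i)"
  let ?T = "idx1 ?tm \<times> idx2 ?tm \<times> idx3 ?tm" and ?T' = "idx1 ?tm' \<times> idx2 ?tm' \<times> idx3 ?tm'"
  let ?TT = "idx1 ?tmm \<times> idx2 ?tmm \<times> idx3 ?tmm"
  have "maps_to ?A ?B ?C (tensor_power t (m + m')) (tensor_power s (n + n'))"
    unfolding maps_to_def
  proof (intro ballI)
    fix p q r
    assume pqr: "p \<in> idx1 (tensor_power s (n + n'))" "q \<in> idx2 (tensor_power s (n + n'))"
      "r \<in> idx3 (tensor_power s (n + n'))"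
    have pqr_take: "take n p \<in> idx1 ?sn" "take n q \<in> idx2 ?sn" "take n r \<in> idx3 ?sn"
      using pqr by (auto dest: in_set_takeD)
    have pqr_drop: "drop n p \<in> idx1 ?sn'" "drop n q \<in> idx2 ?sn'" "drop n r \<in> idx3 ?sn'"
      using pqr by (auto dest: in_set_dropD)
    \<comment> \<open>Concatenation and cutting after \<open>m\<close> letters are inverse
      bijections between triples of long words and pairs of triples of short ones; the sum then
      factors.\<close>
    have "apply_maps ?A ?B ?C (tensor_power t (m + m')) p q r =
      (\<Sum>((i, j, k), (i', j', k'))\<in>?T \<times> ?T'.
        (A (take n p) i * B (take n q) j * C (take n r) k * coeff ?tm i j k) *
        (A' (drop n p) i' * B' (drop n q) j' * C' (drop n r) k' * coeff ?tm' i' j' k'))"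
      unfolding apply_maps_conv_triples
      by (rule sum.reindex_bij_witness[where
          i = "\<lambda>((i, j, k), (i', j', k')). (i @ i', j @ j', k @ k')" and
          j = "\<lambda>(i, j, k). ((take m i, take m j, take m k), (drop m i, drop m j, drop m k))"])
        (auto simp: coeff_tensor_power_append[symmetric] mult_ac dest: in_set_takeD in_set_dropD)
    also have "\<dots> = apply_maps A B C ?tm (take n p) (take n q) (take n r) *
        apply_maps A' B' C' ?tm' (drop n p) (drop n q) (drop n r)"
      unfolding apply_maps_conv_triples sum_product sum.cartesian_product
      by (intro sum.cong refl) auto
    also have "\<dots> = coeff ?sn (take n p) (take n q) (take n r) *
        coeff ?sn' (drop n p) (drop n q) (drop n r)"
      using ts ts' pqr_take pqr_drop unfolding maps_to_def by simp
    also have "\<dots> = coeff (tensor_power s (n + n')) p q r"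
      using pqr by (simp flip: coeff_tensor_power_append)
    finally show "apply_maps ?A ?B ?C (tensor_power t (m + m')) p q r =
      coeff (tensor_power s (n + n')) p q r" .
  qed
  moreover have "gen_sub_permutation (idx1 (tensor_power s (n + n'))) (idx1 (tensor_power t (m + m'))) ?A"
    "gen_sub_permutation (idx2 (tensor_power s (n + n'))) (idx2 (tensor_power t (m + m'))) ?B"
    "gen_sub_permutation (idx3 (tensor_power s (n + n'))) (idx3 (tensor_power t (m + m'))) ?C"
    using gen gen' gen_sub_permutation_append unfolding idx_tensor_power by blast+
  ultimately show ?thesis unfolding mon_restricts_def by blast
qed

section \<open>Fekete's lemma\<close>

lemma subadditive_mult_le:
  fixes f :: "nat \<Rightarrow> nat"
  assumes "f 0 = 0" "\<And>m n. f (m + n) \<le> f m + f n"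
  shows "f (q * k) \<le> q * f k"
proof (induction q)
  case (Suc q)
  then show ?case using assms(2)[of k "q * k"] by simp
qed (simp add: assms)

text \<open>Dividing \<open>n\<close> by \<open>k\<close> with remainder, subadditivity bounds
  \<open>f n / n\<close> by \<open>f k / k + k * f 1 / n\<close>, whose last term vanishes in the
  limit. With \<open>f k / k\<close> close to the infimum this meets the trivial lower
  bound.\<close>

lemma fekete_nat:
  fixes f :: "nat \<Rightarrow> nat"
  assumes f0: "f 0 = 0" and sub: "\<And>m n. f (m + n) \<le> f m + f n"
  shows "(\<lambda>n. f n / n) \<longlonglongrightarrow> (INF n\<in>{1..}. f n / n)" (is "_ \<longlonglongrightarrow> ?L")
proof (rule LIMSEQ_I)
  fix e :: real assume "0 < e"
  have bdd: "bdd_below ((\<lambda>n. f n / n) ` {1..})"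
    by (rule bdd_belowI[of _ 0]) auto
  have "?L < ?L + e / 2" using \<open>0 < e\<close> by simp
  then obtain k where k: "1 \<le> k" "f k / k < ?L + e / 2"
    by (subst (asm) cINF_less_iff[OF _ bdd]) auto
  \<comment> \<open>From \<open>N\<close> on the remainder contributes less than
    \<open>e / 2\<close>; the summand 1 keeps \<open>n\<close> positive.\<close>
  define N where "N = nat \<lceil>2 * k * f 1 / e\<rceil> + 1"
  have "norm (f n / n - ?L) < e" if "n \<ge> N" for n
  proof -
    have n: "n \<ge> 1" "2 * k * f 1 / e < n"
      using that unfolding N_def by linarith+
    have "f n \<le> f (n div k * k) + f (n mod k)"
      using sub[of "n div k * k" "n mod k"] by simp
    also have "\<dots> \<le> n div k * f k + n mod k * f 1"
      using subadditive_mult_le[OF f0 sub, of "n div k" k]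
        subadditive_mult_le[OF f0 sub, of "n mod k" 1] by simp
    also have "\<dots> \<le> n div k * f k + k * f 1"
      using k(1) by (intro add_left_mono mult_right_mono) (auto intro: less_imp_le)
    finally have "real (f n) \<le> real (n div k * f k + k * f 1)"
      by (rule of_nat_mono)
    also have "\<dots> \<le> (n / k) * f k + k * f 1"
      using mult_right_mono[OF of_nat_div_le_of_nat[of n k, where 'a = real], of "f k"] by simp
    finally have "f n / n \<le> ((n / k) * f k + k * f 1) / n"
      by (rule divide_right_mono) simp
    also have "\<dots> = f k / k + k * f 1 / n"
      using n k by (simp add: field_simps)
    also have "k * f 1 / n < e / 2"
      using n \<open>0 < e\<close> by (simp add: field_simps)
    finally have "f n / n < ?L + e" using k(2) by simp
    moreover have "?L \<le> f n / n" using bdd n by (intro cINF_lower) auto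
    ultimately show ?thesis by simp
  qed
  then show "\<exists>N. \<forall>n\<ge>N. norm (f n / n - ?L) < e" by blast
qed

text \<open>If \<open>f 1\<close> is infinite, monotonicity makes all later terms infinite;
  otherwise subadditivity makes every term finite and the version for natural numbers
  applies.\<close>

lemma fekete_ennreal:
  fixes f :: "nat \<Rightarrow> ennreal"
  assumes range: "\<And>n. f n = \<infinity> \<or> (\<exists>m::nat. f n = of_nat m)"
    and f0: "f 0 = 0" and sub: "\<And>m n. f (m + n) \<le> f m + f n" and mono: "mono f"
  shows "(\<lambda>n. f n / of_nat n) \<longlonglongrightarrow> (INF n\<in>{1..}. f n / of_nat n)"
proof (cases "f 1 = \<infinity>")
  case True
  then have inf: "f n = \<infinity>" if "n \<ge> 1" for n
    using monoD[OF mono that] by (simp add: top_unique)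
  have *: "f n / of_nat n = \<infinity>" if "n \<ge> 1" for n
    using inf[OF that] by (simp add: ennreal_top_divide)
  have "(INF n\<in>{1..}. f n / of_nat n) = \<infinity>"
    by (intro antisym INF_greatest) (auto simp: *)
  then show ?thesis
    using * by (intro tendsto_eventually) (auto simp: eventually_sequentially intro!: exI[of _ 1])
next
  case False
  have fin: "f n \<noteq> \<infinity>" for n
  proof (induction n)
    case (Suc n)
    then show ?case using sub[of n 1] False by (auto simp: top_unique)
  qed (simp add: f0)
  then have "\<exists>m::nat. f n = of_nat m" for n using range[of n] by blast
  then obtain g :: "nat \<Rightarrow> nat" where g: "f n = of_nat (g n)" for n by metis
  have g0: "g 0 = 0" using f0 by (simp add: g)
  have gsub: "g (m + n) \<le> g m + g n" for m n
    using sub[of m n] by (simp add: g flip: of_nat_add)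
  have eq: "f n / of_nat n = ennreal (g n / n)" if "n \<ge> 1" for n
    using that by (simp add: g ennreal_of_nat_eq_real_of_nat divide_ennreal)
  have bdd: "bdd_below ((\<lambda>n. g n / n) ` {1..})"
    by (rule bdd_belowI[of _ 0]) auto
  let ?L = "INF n\<in>{1..}. g n / n"
  have "(\<lambda>n. ennreal (g n / n)) \<longlonglongrightarrow> ennreal ?L"
    by (intro tendsto_ennrealI fekete_nat g0 gsub)
  then have lim: "(\<lambda>n. f n / of_nat n) \<longlonglongrightarrow> ennreal ?L"
    by (rule Lim_transform_eventually) (auto simp: eventually_sequentially eq intro!: exI[of _ 1])
  have "(INF n\<in>{1..}. f n / of_nat n) = (INF n\<in>{1..}. ennreal (g n / n))"
    by (intro INF_cong) (auto simp: eq)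
  also have "\<dots> = ennreal ?L"
  proof (rule antisym)
    \<comment> \<open>The infimum is below every term from 1 on, hence below their limit.\<close>
    show "(INF n\<in>{1..}. ennreal (g n / n)) \<le> ennreal ?L"
      using lim by (rule LIMSEQ_le_const) (auto simp: eq intro!: INF_lower exI[of _ 1])
    show "ennreal ?L \<le> (INF n\<in>{1..}. ennreal (g n / n))"
      using bdd by (intro INF_greatest ennreal_leI cINF_lower) auto
  qed
  finally show ?thesis using lim by simp
qed

section \<open>Behrend's spheres and edge-disjoint triangles\<close>

text \<open>By the parallelogram law |a - b|^2 = 2|a|^2 + 2|b|^2 - |a + b|^2, which is 2r + 2r - 4r
  = 0 when a + b = 2c.\<close>

lemma sphere_no_midpoint:
  fixes a b c :: "'l \<Rightarrow> nat"
  assumes "finite I" "(\<Sum>l\<in>I. (a l)\<^sup>2) = r" "(\<Sum>l\<in>I. (b l)\<^sup>2) = r" "(\<Sum>l\<in>I. (c l)\<^sup>2) = r"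
    and mid: "\<And>l. l \<in> I \<Longrightarrow> a l + b l = 2 * c l"
    and "l \<in> I"
  shows "a l = c l \<and> b l = c l"
proof -
  \<comment> \<open>Differences are taken in the integers because subtraction on \<open>nat\<close>
    truncates.\<close>
  have "(int (a l) - int (b l))\<^sup>2 = 2 * int ((a l)\<^sup>2) + 2 * int ((b l)\<^sup>2) - 4 * int ((c l)\<^sup>2)"
    if "l \<in> I" for l
  proof -
    have c: "2 * int (c l) = int (a l) + int (b l)" using mid[OF that] by linarith
    have "4 * (int (c l))\<^sup>2 = (2 * int (c l))\<^sup>2" by (simp add: power2_eq_square)
    then show ?thesis unfolding c by (simp add: power2_eq_square algebra_simps)
  qed
  then have "(\<Sum>l\<in>I. (int (a l) - int (b l))\<^sup>2) =
      2 * int (\<Sum>l\<in>I. (a l)\<^sup>2) + 2 * int (\<Sum>l\<in>I. (b l)\<^sup>2) - 4 * int (\<Sum>l\<in>I. (c l)\<^sup>2)"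
    by (simp add: sum.distrib sum_subtractf sum_distrib_left)
  also have "\<dots> = 0" using assms(2-4) by simp
  finally have "a l = b l"
    using assms(1,6) by (subst (asm) sum_nonneg_eq_0_iff) auto
  with mid[OF \<open>l \<in> I\<close>] show ?thesis by simp
qed

text \<open>The m^d points of the cube have squared norms below d m^2, so some sphere holds at least
  the average number of them.\<close>

lemma sphere_pigeonhole:
  fixes d m :: nat
  assumes "d \<ge> 1" "m \<ge> 1"
  obtains r where "m ^ d \<le> card {a \<in> {..<d} \<rightarrow>\<^sub>E {..<m}. (\<Sum>l<d. (a l)\<^sup>2) = r} * (d * m\<^sup>2)"
proof -
  let ?V = "{..<d} \<rightarrow>\<^sub>E {..<m}" and ?f = "\<lambda>a. \<Sum>l<d. (a l :: nat)\<^sup>2"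
  have "?f \<in> ?V \<rightarrow> {..<d * m\<^sup>2}"
  proof
    fix a assume "a \<in> ?V"
    then have "(a l)\<^sup>2 < m\<^sup>2" if "l < d" for l
      using that by (intro power_strict_mono) (auto simp: PiE_def Pi_def)
    then have "?f a < (\<Sum>l<d. m\<^sup>2)"
      using assms by (intro sum_strict_mono) (auto simp: lessThan_empty_iff)
    then show "?f a \<in> {..<d * m\<^sup>2}" by simp
  qed
  moreover have "finite ?V" by (auto intro: finite_PiE)
  ultimately obtain r where "card ?V \<le> card (?f -` {r} \<inter> ?V) * card {..<d * m\<^sup>2}"
    using pigeonhole_card[of ?f ?V "{..<d * m\<^sup>2}"] assms by (auto simp: lessThan_empty_iff)
  also have "?f -` {r} \<inter> ?V = {a \<in> ?V. ?f a = r}" by auto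
  finally show ?thesis using that by (simp add: card_funcsetE)
qed

text \<open>The Ruzsa--Szemeredi construction with Behrend's set: the triangles are
  \<open>(x, x + a, x + 2a)\<close> with \<open>a\<close> on a sphere. For three of them that
  contribute one edge each to a triangle, closing up gives \<open>a + a' = 2a''\<close>.\<close>

lemma disjoint_triangles:
  fixes d :: nat and W :: "'w set"
  assumes "d \<ge> 2" "finite W" "2 ^ (d * (d + 2)) \<le> card W"
  obtains T :: "('w \<times> 'w \<times> 'w) set" where "T \<subseteq> W \<times> W \<times> W" "2 ^ (d * (2 * d - 3)) \<le> card T"
    "\<And>i j k i' j' k'. (i, j, k') \<in> T \<Longrightarrow> (i', j, k) \<in> T \<Longrightarrow> (i, j', k) \<in> T \<Longrightarrow> i' = i \<and> j' = j \<and> k' = k"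
proof -
  \<comment> \<open>With this side length the pigeonhole loss d m^2 is at most 2^(3 d), of lower
    order than m^(2 d) = 2^(2 d^2).\<close>
  define m :: nat where "m = 2 ^ d"
  let ?D = "{..<d}"
  \<comment> \<open>Coordinates of x + 2a stay below 3m; the bound 4m makes the number of vertices
    exactly 2^(d (d + 2)).\<close>
  let ?V = "?D \<rightarrow>\<^sub>E {..<m}" and ?U = "?D \<rightarrow>\<^sub>E {..<4 * m}"
  obtain r where r: "m ^ d \<le> card {a \<in> ?V. (\<Sum>l<d. (a l)\<^sup>2) = r} * (d * m\<^sup>2)"
    using sphere_pigeonhole[of d m] assms(1) by (auto simp: m_def)
  define S where "S = {a \<in> ?V. (\<Sum>l<d. (a l)\<^sup>2) = r}"
  have finU: "finite ?U" by (auto intro: finite_PiE)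
  have finV: "finite ?V" by (auto intro: finite_PiE)
  have "card ?U = 2 ^ (d * (d + 2))"
  proof -
    have "4 * m = 2 ^ (d + 2)" by (simp add: m_def power_add)
    then show ?thesis by (simp only: card_funcsetE finite_lessThan card_lessThan mult.commute flip: power_mult)
  qed
  then obtain \<phi> where \<phi>: "\<phi> ` ?U \<subseteq> W" "inj_on \<phi> ?U"
    using card_le_inj[of ?U W] finU assms by auto
  \<comment> \<open>Restricting to \<open>?D\<close> keeps the result extensional, as membership in
    \<open>?U\<close> demands.\<close>
  define shift where "shift = (\<lambda>c x a. \<lambda>l\<in>?D. x l + c * a l :: nat)"
  have shift: "shift c x a \<in> ?U" if "x \<in> ?V" "a \<in> S" "c \<le> 2" for c x a
  proof -
    have "x l + c * a l < 4 * m" if "l < d" for l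
    proof -
      have "x l < m" "a l < m" using that \<open>x \<in> ?V\<close> \<open>a \<in> S\<close> by (auto simp: S_def PiE_def Pi_def)
      moreover have "c * a l \<le> 2 * a l" using \<open>c \<le> 2\<close> by simp
      ultimately show ?thesis by linarith
    qed
    then show ?thesis by (auto simp: shift_def)
  qed
  define tri where "tri = (\<lambda>(x, a). (\<phi> (shift 0 x a), \<phi> (shift 1 x a), \<phi> (shift 2 x a)))"
  have shift_eq: "x l + c * a l = x' l + c * a' l"
    if "\<phi> (shift c x a) = \<phi> (shift c x' a')" "x \<in> ?V" "a \<in> S" "x' \<in> ?V" "a' \<in> S" "c \<le> 2" "l < d"
    for c x a x' a' l
  proof -
    have "shift c x a = shift c x' a'"
      by (rule inj_onD[OF \<phi>(2)]) (intro shift that)+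
    from fun_cong[OF this, of l] show ?thesis using that by (simp add: shift_def)
  qed
  \<comment> \<open>The hypotheses \<open>i\<close>, \<open>j\<close>, \<open>k\<close> say that one
    edge from each of three triangles closes up to a triangle.\<close>
  have key: "x' = x \<and> a' = a \<and> x'' = x \<and> a'' = a"
    if "x \<in> ?V" "a \<in> S" "x' \<in> ?V" "a' \<in> S" "x'' \<in> ?V" "a'' \<in> S"
      and i: "\<phi> (shift 0 x a) = \<phi> (shift 0 x'' a'')"
      and j: "\<phi> (shift 1 x a) = \<phi> (shift 1 x' a')"
      and k: "\<phi> (shift 2 x' a') = \<phi> (shift 2 x'' a'')" for x a x' a' x'' a''
  proof -
    have eqs: "x l = x'' l" "x l + a l = x' l + a' l" "x' l + 2 * a' l = x'' l + 2 * a'' l"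
      if l: "l < d" for l
      using shift_eq[OF i _ _ _ _ _ l] shift_eq[OF j _ _ _ _ _ l] shift_eq[OF k _ _ _ _ _ l]
        \<open>x \<in> ?V\<close> \<open>a \<in> S\<close> \<open>x' \<in> ?V\<close> \<open>a' \<in> S\<close> \<open>x'' \<in> ?V\<close> \<open>a'' \<in> S\<close> by simp_all
    have "a l = a'' l \<and> a' l = a'' l" if "l < d" for l
    proof (rule sphere_no_midpoint[of ?D a r a' a''])
      \<comment> \<open>Substitute x = x'' and eliminate x' between the other two equations of
        \<open>eqs\<close>.\<close>
      show "a l + a' l = 2 * a'' l" if "l \<in> ?D" for l
        using eqs[of l] that by simp
    qed (use that \<open>a \<in> S\<close> \<open>a' \<in> S\<close> \<open>a'' \<in> S\<close> in \<open>auto simp: S_def\<close>)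
    then have *: "a l = a'' l" "a' l = a'' l" "x l = x'' l" "x' l = x'' l" if "l < d" for l
      using eqs[OF that] that by fastforce+
    have aV: "a \<in> ?V" "a' \<in> ?V" "a'' \<in> ?V" using that by (auto simp: S_def)
    have "a = a''" "a' = a''" "x = x''" "x' = x''"
      by (rule PiE_ext[of _ ?D "\<lambda>_. {..<m}"]; use * aV that in simp)+
    then show ?thesis by simp
  qed
  show ?thesis
  proof
    show "tri ` (?V \<times> S) \<subseteq> W \<times> W \<times> W"
      using \<phi>(1) shift by (force simp: tri_def image_subset_iff)
    \<comment> \<open>Equal triangles agree in all three vertices, so \<open>key\<close> applies
      with one of the two used twice.\<close>
    have "inj_on tri (?V \<times> S)"
      using key by (auto simp: inj_on_def tri_def)
    then have "card (tri ` (?V \<times> S)) = m ^ d * card S"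
      by (simp add: card_image card_cartesian_product card_funcsetE)
    \<comment> \<open>The bound 2^(3 d) for d m^2 is multiplied in and cancelled afterwards, which
      avoids division; it is the source of the -3 in the exponent. As d is at least 2, the
      subtraction on \<open>nat\<close> is exact.\<close>
    moreover have "2 ^ (d * (2 * d - 3)) * 2 ^ (3 * d) \<le> m ^ d * card S * 2 ^ (3 * d)"
    proof -
      have "d * (2 * d - 3) + 3 * d = d * d + d * d"
        using assms(1) by (simp add: algebra_simps)
      then have "2 ^ (d * (2 * d - 3)) * 2 ^ (3 * d) = m ^ d * m ^ d"
        by (simp add: m_def flip: power_add power_mult)
      also have "\<dots> \<le> m ^ d * (card S * (d * m\<^sup>2))"
        using r by (simp add: S_def)
      also have "d * m\<^sup>2 \<le> 2 ^ d * m\<^sup>2"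
        by (simp add: less_imp_le)
      also have "2 ^ d * m\<^sup>2 = 2 ^ (3 * d)"
        by (simp add: m_def flip: power_add power_mult)
      finally show ?thesis by (simp add: mult.assoc)
    qed
    ultimately show "2 ^ (d * (2 * d - 3)) \<le> card (tri ` (?V \<times> S))"
      by simp
    show "i' = i \<and> j' = j \<and> k' = k"
      if T: "(i, j, k') \<in> tri ` (?V \<times> S)" "(i', j, k) \<in> tri ` (?V \<times> S)" "(i, j', k) \<in> tri ` (?V \<times> S)"
      for i j k i' j' k'
    proof -
      obtain x a where 1: "x \<in> ?V" "a \<in> S" "(i, j, k') = tri (x, a)" using T(1) by auto
      obtain x' a' where 2: "x' \<in> ?V" "a' \<in> S" "(i', j, k) = tri (x', a')" using T(2) by auto
      obtain x'' a'' where 3: "x'' \<in> ?V" "a'' \<in> S" "(i, j', k) = tri (x'', a'')" using T(3) by auto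
      have "x' = x \<and> a' = a \<and> x'' = x \<and> a'' = a"
        by (rule key) (use 1 2 3 in \<open>auto simp: tri_def\<close>)
      then show ?thesis using 1 2 3 by (auto simp: tri_def)
    qed
  qed
qed

section \<open>Coefficients of unit and matrix multiplication tensors\<close>

lemma unit_tensor_simps [simp]:
  "idx1 (unit_tensor n) = {1..n}" "idx2 (unit_tensor n) = {1..n}" "idx3 (unit_tensor n) = {1..n}"
  by (simp_all add: unit_tensor_def)

lemma coeff_unit_tensor:
  assumes "p \<in> {1..n}"
  shows "coeff (unit_tensor n) p q r = (if p = q \<and> q = r then 1 else 0)"
proof -
  have "coeff (unit_tensor n) p q r = (\<Sum>i=1..n. if p = i then std_basis i q * std_basis i r else 0)"
    unfolding unit_tensor_def tensor3.select_convs
    by (intro sum.cong refl) (auto simp: std_basis_def)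
  then show ?thesis using assms by (auto simp: std_basis_def)
qed

lemma matmul_tensor_simps [simp]:
  "idx1 (matmul_tensor a b c) = {1..a} \<times> {1..b}" "idx2 (matmul_tensor a b c) = {1..b} \<times> {1..c}"
  "idx3 (matmul_tensor a b c) = {1..c} \<times> {1..a}"
  by (simp_all add: matmul_tensor_def)

lemma coeff_matmul_tensor:
  assumes "p \<in> {1..a} \<times> {1..b}" "r \<in> {1..c} \<times> {1..a}"
  shows "coeff (matmul_tensor a b c) p q r =
    (if snd p = fst q \<and> snd q = fst r \<and> snd r = fst p then 1 else 0)"
proof -
  \<comment> \<open>The entries of \<open>p\<close> and \<open>r\<close> fix i, j and k;
    conditionals ordered from the innermost sum outwards let the sums collapse.\<close>
  have "coeff (matmul_tensor a b c) p q r = (\<Sum>i=1..a. \<Sum>j=1..b. \<Sum>k=1..c.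
      if fst r = k then if snd p = j then if fst p = i
      then std_basis (j, k) q * std_basis (k, i) r else 0 else 0 else 0)"
    unfolding matmul_tensor_def tensor3.select_convs
    by (intro sum.cong refl) (auto simp: std_basis_def)
  then show ?thesis using assms by (auto simp: std_basis_def)
qed

lemma prod_indicator_eq:
  fixes P :: "'l \<Rightarrow> bool"
  assumes "finite I"
  shows "(\<Prod>l\<in>I. if P l then 1 else 0 :: 'a::field) = (if \<forall>l\<in>I. P l then 1 else 0)"
  using assms by (auto intro: prod.neutral)

text \<open>The power is the unit tensor on words of length \<open>h\<close>: a product of
  indicators over the positions is the indicator of equality of words.\<close>

lemma coeff_unit_tensor_power:
  assumes "p \<in> idx1 (tensor_power (unit_tensor n) h)" "length q = h" "length r = h"
  shows "coeff (tensor_power (unit_tensor n) h) p q r = (if p = q \<and> q = r then 1 else 0)"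
proof -
  have "coeff (tensor_power (unit_tensor n) h) p q r =
      (\<Prod>l<h. if p ! l = q ! l \<and> q ! l = r ! l then 1 else 0)"
    unfolding coeff_tensor_power
    using assms by (intro prod.cong refl coeff_unit_tensor) (auto dest: subsetD[OF _ nth_mem])
  then show ?thesis using assms by (auto simp: prod_indicator_eq list_eq_iff_nth_eq)
qed

text \<open>The power is a matrix multiplication tensor on words: each basis vector zips two words
  and is the edge between them, and the coefficient tests whether three edges form a triangle. The
  index sets of powers of unit tensors merely stand for sets of words.\<close>

lemma coeff_matmul_tensor_power_zip:
  assumes "i \<in> idx1 (tensor_power (unit_tensor a) n)" "i' \<in> idx1 (tensor_power (unit_tensor a) n)"
    "j \<in> idx1 (tensor_power (unit_tensor b) n)" "j' \<in> idx1 (tensor_power (unit_tensor b) n)"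
    "k \<in> idx1 (tensor_power (unit_tensor c) n)" "k' \<in> idx1 (tensor_power (unit_tensor c) n)"
  shows "coeff (tensor_power (matmul_tensor a b c) n) (zip i j) (zip j' k) (zip k' i') =
    (if i = i' \<and> j = j' \<and> k = k' then 1 else 0)"
proof -
  have "coeff (tensor_power (matmul_tensor a b c) n) (zip i j) (zip j' k) (zip k' i') =
      (\<Prod>l<n. if j ! l = j' ! l \<and> k ! l = k' ! l \<and> i ! l = i' ! l then 1 else 0)"
    unfolding coeff_tensor_power
  proof (intro prod.cong refl)
    fix l assume "l \<in> {..<n}"
    then show "coeff (matmul_tensor a b c) (zip i j ! l) (zip j' k ! l) (zip k' i' ! l) =
        (if j ! l = j' ! l \<and> k ! l = k' ! l \<and> i ! l = i' ! l then 1 else 0)"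
      using assms by (subst coeff_matmul_tensor) (auto dest: subsetD[OF _ nth_mem])
  qed
  moreover have "(\<forall>l\<in>{..<n}. j ! l = j' ! l \<and> k ! l = k' ! l \<and> i ! l = i' ! l) \<longleftrightarrow>
      i = i' \<and> j = j' \<and> k = k'"
    using assms by (auto simp: list_eq_iff_nth_eq)
  ultimately show ?thesis by (simp add: prod_indicator_eq)
qed

section \<open>Unit tensors inside powers of the matrix multiplication tensor\<close>

text \<open>The words of length d (d + 2) are the vertices on each side of the tripartite graph. At
  least 2^h disjoint triangles exist for h = d (2 d - 3); indexing 2^h of them by words of length h
  and sending each index to its three edges gives the embedding.\<close>

lemma matmul_power_mon_restricts_unit_power:
  assumes "d \<ge> 2"
  shows "mon_restricts
    (tensor_power (matmul_tensor 2 2 2 :: (nat \<times> nat, nat \<times> nat, nat \<times> nat, 'a::field) tensor3) (d * (d + 2)))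
    (tensor_power (unit_tensor 2) (d * (2 * d - 3)))"
proof -
  define n h where "n = d * (d + 2)" and "h = d * (2 * d - 3)"
  let ?u = "unit_tensor 2 :: (nat, nat, nat, 'a) tensor3"
  let ?m = "matmul_tensor 2 2 2 :: (nat \<times> nat, nat \<times> nat, nat \<times> nat, 'a) tensor3"
  let ?W = "{w. set w \<subseteq> {1..2::nat} \<and> length w = n}"
  let ?P = "{w. set w \<subseteq> {1..2::nat} \<and> length w = h}"
  have fin: "finite ?W" "finite ?P"
    by (simp_all add: finite_lists_length_eq)
  have card: "card ?W = 2 ^ n" "card ?P = 2 ^ h"
    by (simp_all add: card_lists_length_eq)
  have "2 ^ (d * (d + 2)) \<le> card ?W"
    unfolding card(1) unfolding n_def by (rule order_refl)
  then obtain T where T: "T \<subseteq> ?W \<times> ?W \<times> ?W" "2 ^ h \<le> card T"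
    and triangle: "\<And>i j k i' j' k'. (i, j, k') \<in> T \<Longrightarrow> (i', j, k) \<in> T \<Longrightarrow> (i, j', k) \<in> T \<Longrightarrow>
      i' = i \<and> j' = j \<and> k' = k"
  proof (rule disjoint_triangles[OF assms fin(1), folded h_def])
    fix T assume "T \<subseteq> ?W \<times> ?W \<times> ?W" "2 ^ h \<le> card T"
      "\<And>i j k i' j' k'. (i, j, k') \<in> T \<Longrightarrow> (i', j, k) \<in> T \<Longrightarrow> (i, j', k) \<in> T \<Longrightarrow>
        i' = i \<and> j' = j \<and> k' = k"
    then show thesis by (rule that)
  qed
  have "finite T" using T(1) fin(1) by (auto intro: finite_subset)
  then obtain \<tau> where \<tau>: "\<tau> ` ?P \<subseteq> T" "inj_on \<tau> ?P"
    using card_le_inj[OF fin(2), of T] T(2) unfolding card(2) by blast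
  define i j k where "i = (\<lambda>p. fst (\<tau> p))" and "j = (\<lambda>p. fst (snd (\<tau> p)))" and "k = (\<lambda>p. snd (snd (\<tau> p)))"
  have \<tau>T: "(i p, j p, k p) \<in> T" if "p \<in> ?P" for p
    using that \<tau>(1) by (auto simp: i_def j_def k_def)
  then have W: "i p \<in> ?W" "j p \<in> ?W" "k p \<in> ?W" if "p \<in> ?P" for p
    using T(1) that by blast+
  \<comment> \<open>If an edge of each of the triangles of \<open>p\<close>, \<open>q\<close>,
    \<open>r\<close> close up, the property of \<open>T\<close> makes the triangles equal, and
    injectivity of \<open>\<tau>\<close> identifies the indices.\<close>
  have ijk: "p = q \<and> q = r" if "i r = i p" "j q = j p" "k r = k q" "p \<in> ?P" "q \<in> ?P" "r \<in> ?P" for p q r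
  proof -
    have "i q = i p \<and> j r = j p \<and> k p = k q"
      using triangle[of "i p" "j p" "k p" "i q" "k q" "j r"] \<tau>T[OF that(4)] \<tau>T[OF that(5)] \<tau>T[OF that(6)]
        that(1-3) by simp
    then have "\<tau> p = \<tau> q" "\<tau> q = \<tau> r"
      using that(1-3) by (auto simp: i_def j_def k_def prod_eq_iff)
    then show ?thesis using \<tau>(2) that by (auto simp: inj_on_def)
  qed
  have zip_inj: "x = x' \<and> y = y'" if "zip x y = zip x' y'" "x \<in> ?W" "y \<in> ?W" "x' \<in> ?W" "y' \<in> ?W" for x y x' y'
  proof -
    have "map fst (zip x y) = map fst (zip x' y')" "map snd (zip x y) = map snd (zip x' y')"
      using that(1) by simp_all
    then show ?thesis using that(2-) by simp
  qed
  have zip_W: "zip x y \<in> {w. set w \<subseteq> {1..2} \<times> {1..2} \<and> length w = n}" if "x \<in> ?W" "y \<in> ?W" for x y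
    using that by (auto dest: set_zip_leftD set_zip_rightD)
  have "mon_restricts (tensor_power ?m n) (tensor_power ?u h)"
  proof (rule mon_restricts_embedding[where \<alpha> = "\<lambda>p. zip (i p) (j p)" and
        \<beta> = "\<lambda>p. zip (j p) (k p)" and \<gamma> = "\<lambda>p. zip (k p) (i p)"])
    show "finite (idx1 (tensor_power ?m n))" "finite (idx2 (tensor_power ?m n))"
      "finite (idx3 (tensor_power ?m n))"
      by (simp_all add: finite_lists_length_eq)
    \<comment> \<open>An edge shared by \<open>p\<close> and \<open>q\<close> closes up with the
      other two edges of \<open>q\<close>, so \<open>ijk\<close> also yields injectivity. The other
      two kinds of edges are treated alike.\<close>
    have "inj_on (\<lambda>p. zip (i p) (j p)) ?P"
    proof (rule inj_onI)
      fix p q assume *: "p \<in> ?P" "q \<in> ?P" "zip (i p) (j p) = zip (i q) (j q)"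
      note eq = zip_inj[OF *(3) W(1,2)[OF *(1)] W(1,2)[OF *(2)]]
      show "p = q" by (intro ijk[where p = p and q = q and r = q, THEN conjunct1]) (simp_all only: eq *(1,2))
    qed
    then show "inj_on (\<lambda>p. zip (i p) (j p)) (idx1 (tensor_power ?u h))" by simp
    have "inj_on (\<lambda>p. zip (j p) (k p)) ?P"
    proof (rule inj_onI)
      fix p q assume *: "p \<in> ?P" "q \<in> ?P" "zip (j p) (k p) = zip (j q) (k q)"
      note eq = zip_inj[OF *(3) W(2,3)[OF *(1)] W(2,3)[OF *(2)]]
      show "p = q" by (intro ijk[where p = q and q = p and r = q, THEN conjunct2]) (simp_all only: eq *(1,2))
    qed
    then show "inj_on (\<lambda>p. zip (j p) (k p)) (idx2 (tensor_power ?u h))" by simp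
    have "inj_on (\<lambda>p. zip (k p) (i p)) ?P"
    proof (rule inj_onI)
      fix p q assume *: "p \<in> ?P" "q \<in> ?P" "zip (k p) (i p) = zip (k q) (i q)"
      note eq = zip_inj[OF *(3) W(3,1)[OF *(1)] W(3,1)[OF *(2)]]
      show "p = q" by (intro ijk[where p = q and q = q and r = p, THEN conjunct2, symmetric]) (simp_all only: eq *(1,2))
    qed
    then show "inj_on (\<lambda>p. zip (k p) (i p)) (idx3 (tensor_power ?u h))" by simp
    show "(\<lambda>p. zip (i p) (j p)) ` idx1 (tensor_power ?u h) \<subseteq> idx1 (tensor_power ?m n)"
      "(\<lambda>p. zip (j p) (k p)) ` idx2 (tensor_power ?u h) \<subseteq> idx2 (tensor_power ?m n)"
      "(\<lambda>p. zip (k p) (i p)) ` idx3 (tensor_power ?u h) \<subseteq> idx3 (tensor_power ?m n)"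
      unfolding idx_tensor_power unit_tensor_simps matmul_tensor_simps
      by (intro image_subsetI zip_W W; assumption)+
    fix p q r
    assume "p \<in> idx1 (tensor_power ?u h)" "q \<in> idx2 (tensor_power ?u h)" "r \<in> idx3 (tensor_power ?u h)"
    then have pqr: "p \<in> ?P" "q \<in> ?P" "r \<in> ?P" by simp_all
    have "coeff (tensor_power ?m n) (zip (i p) (j p)) (zip (j q) (k q)) (zip (k r) (i r)) =
        (if i p = i r \<and> j p = j q \<and> k q = k r then 1 else 0)"
      by (rule coeff_matmul_tensor_power_zip) (use W pqr in auto)
    also have "\<dots> = (if p = q \<and> q = r then 1 else 0)"
      using ijk[where p = p and q = q and r = r] pqr by auto
    also have "\<dots> = coeff (tensor_power ?u h) p q r"
      using pqr by (subst coeff_unit_tensor_power) auto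
    finally show "coeff (tensor_power ?m n) (zip (i p) (j p)) (zip (j q) (k q)) (zip (k r) (i r)) =
      coeff (tensor_power ?u h) p q r" .
  qed
  then show ?thesis by (simp add: n_def h_def)
qed

section \<open>Monomial costs and their limits\<close>

text \<open>The numerator in \<open>omega_mon\<close>, named so that Fekete's lemma can be applied
  to it.\<close>

definition mon_cost :: "('i, 'j, 'k, 'a::field) tensor3 \<Rightarrow> ('p, 'q, 'r, 'a) tensor3 \<Rightarrow> nat \<Rightarrow> ennreal"
  where "mon_cost t s n = (INF m\<in>{m. mon_restricts (tensor_power t m) (tensor_power s n)}. of_nat m)"

lemma omega_mon_eq_lim: "omega_mon t s = lim (\<lambda>n. mon_cost t s n / of_nat n)"
  by (simp add: omega_mon_def mon_cost_def)

lemma mon_cost_le: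
  "mon_restricts (tensor_power t m) (tensor_power s n) \<Longrightarrow> mon_cost t s n \<le> of_nat m"
  unfolding mon_cost_def by (auto intro: INF_lower)

text \<open>A nonempty set of natural numbers attains its infimum, so a finite cost comes with an
  optimal restriction.\<close>

lemma mon_cost_cases:
  obtains "mon_cost t s n = \<infinity>"
  | m where "mon_cost t s n = of_nat m" "mon_restricts (tensor_power t m) (tensor_power s n)"
proof (cases "\<exists>m. mon_restricts (tensor_power t m) (tensor_power s n)")
  case True
  define m where "m = (LEAST m. mon_restricts (tensor_power t m) (tensor_power s n))"
  have m: "mon_restricts (tensor_power t m) (tensor_power s n)"
    unfolding m_def using True by (rule LeastI_ex)
  have "of_nat m \<le> mon_cost t s n"
    unfolding mon_cost_def m_def by (auto intro!: INF_greatest Least_le)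
  with mon_cost_le[OF m] m show ?thesis using that(2) by (metis antisym)
next
  case False
  then have "mon_cost t s n = \<infinity>" by (simp add: mon_cost_def)
  then show ?thesis by (rule that(1))
qed

lemma mon_cost_mono_target:
  assumes "mon_restricts (tensor_power s n) (tensor_power u h)"
  shows "mon_cost t u h \<le> mon_cost t s n"
proof (cases rule: mon_cost_cases[of t s n])
  case (2 m)
  then show ?thesis using mon_restricts_trans[OF _ assms] mon_cost_le by metis
qed simp

lemma mon_cost_add: "mon_cost t s (n + n') \<le> mon_cost t s n + mon_cost t s n'"
proof (cases rule: mon_cost_cases[of t s n])
  case (2 m)
  note m = this
  show ?thesis
  proof (cases rule: mon_cost_cases[of t s n'])
    case (2 m')
    then show ?thesis
      using mon_cost_le[OF mon_restricts_tensor_power_add[OF m(2) 2(2)]] m(1) by simp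
  qed simp
qed simp

lemma mon_cost_0: "mon_cost t s 0 = 0"
proof -
  \<comment> \<open>Both zeroth powers have the empty word as their only index and the empty product
    as coefficient.\<close>
  have "mon_restricts (tensor_power t 0) (tensor_power s 0)"
    by (rule mon_restricts_embedding[where \<alpha> = "\<lambda>_. []" and \<beta> = "\<lambda>_. []" and \<gamma> = "\<lambda>_. []"])
      (auto simp: coeff_tensor_power inj_on_def)
  from mon_cost_le[OF this] show ?thesis by simp
qed

text \<open>The entry \<open>1\<close> makes the cost monotone in the exponent of \<open>s\<close>, so that it is either always
  finite or infinite from the exponent \<open>1\<close> on. Otherwise the limit might not exist.\<close>

lemma mon_cost_mono:
  assumes fin: "finite (idx1 s)" "finite (idx2 s)" "finite (idx3 s)"
    and idx: "a \<in> idx1 s" "b \<in> idx2 s" "c \<in> idx3 s" and coeff: "coeff s a b c = 1"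
  shows "mono (mon_cost t s)"
proof (rule mono_iff_le_Suc[THEN iffD2], intro allI mon_cost_mono_target)
  fix n
  have 1: "coeff (tensor_power s 1) [a] [b] [c] = 1"
    using coeff by (simp add: coeff_tensor_power)
  \<comment> \<open>Padding every word with the index of the entry 1 preserves coefficients.\<close>
  show "mon_restricts (tensor_power s (Suc n)) (tensor_power s n)"
    by (rule mon_restricts_embedding[where
          \<alpha> = "\<lambda>p. p @ [a]" and \<beta> = "\<lambda>q. q @ [b]" and \<gamma> = "\<lambda>r. r @ [c]"])
      (use fin idx 1 coeff_tensor_power_append[of _ n _ _ s 1] in
        \<open>auto simp: finite_lists_length_eq inj_on_def\<close>)
qed

text \<open>The \<open>lim\<close> in \<open>omega_mon\<close> is informative only once convergence
  is known. By Fekete the limit is an infimum, hence a lower bound at each positive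
  exponent.\<close>

lemma mon_cost_tendsto:
  assumes "finite (idx1 s)" "finite (idx2 s)" "finite (idx3 s)"
    and "a \<in> idx1 s" "b \<in> idx2 s" "c \<in> idx3 s" "coeff s a b c = 1"
  shows "(\<lambda>n. mon_cost t s n / of_nat n) \<longlonglongrightarrow> omega_mon t s"
    and "n \<ge> 1 \<Longrightarrow> omega_mon t s \<le> mon_cost t s n / of_nat n"
proof -
  have "(\<lambda>n. mon_cost t s n / of_nat n) \<longlonglongrightarrow> (INF n\<in>{1..}. mon_cost t s n / of_nat n)"
  proof (rule fekete_ennreal)
    show "mon_cost t s n = \<infinity> \<or> (\<exists>m::nat. mon_cost t s n = of_nat m)" for n
      by (cases rule: mon_cost_cases[of t s n]) auto
  qed (use mon_cost_0 mon_cost_add mon_cost_mono[OF assms] in auto)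
  moreover from limI[OF this]
  have *: "omega_mon t s = (INF n\<in>{1..}. mon_cost t s n / of_nat n)"
    by (simp add: omega_mon_eq_lim)
  ultimately show "(\<lambda>n. mon_cost t s n / of_nat n) \<longlonglongrightarrow> omega_mon t s" by simp
  show "n \<ge> 1 \<Longrightarrow> omega_mon t s \<le> mon_cost t s n / of_nat n"
    using INF_lower[of n "{1..}" "\<lambda>n. mon_cost t s n / of_nat n"] by (simp add: *)
qed

section \<open>Comparison of the asymptotic exponents\<close>

text \<open>The infimum property gives ?F h <= cost of the h-th power of <2>, which is at most the
  cost of the N-th power of <2,2,2>. Dividing by N and letting d grow gives the claim, as h / N
  tends to 2.\<close>

lemma omega_mon_matmul_ge:
  fixes t :: "('i, 'j, 'k, 'a::field) tensor3"
  shows "2 * omega_mon t (unit_tensor 2 :: (nat, nat, nat, 'a) tensor3) \<le>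
    omega_mon t (matmul_tensor 2 2 2 :: (nat \<times> nat, nat \<times> nat, nat \<times> nat, 'a) tensor3)"
    (is "2 * ?F \<le> ?G")
proof -
  let ?u = "unit_tensor 2 :: (nat, nat, nat, 'a) tensor3"
  let ?m = "matmul_tensor 2 2 2 :: (nat \<times> nat, nat \<times> nat, nat \<times> nat, 'a) tensor3"
  have "?F \<le> mon_cost t ?u n / of_nat n" if "n \<ge> 1" for n
    by (rule mon_cost_tendsto(2)[where a = 1 and b = 1 and c = 1])
      (use that in \<open>auto simp: coeff_unit_tensor\<close>)
  note F = this
  have G: "(\<lambda>n. mon_cost t ?m n / of_nat n) \<longlonglongrightarrow> ?G"
    by (rule mon_cost_tendsto(1)[where a = "(1, 1)" and b = "(1, 1)" and c = "(1, 1)"])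
      (auto simp: coeff_matmul_tensor)
  define N where "N = (\<lambda>d::nat. d * (d + 2))"
  \<comment> \<open>The ratio h / N with the common factor d cancelled. It is negative for d < 2,
    where \<open>ennreal\<close> sends it to 0; only d >= 2 is compared below.\<close>
  define q where "q = (\<lambda>d::nat. (2 * real d - 3) / (real d + 2))"
  have "strict_mono N"
    unfolding N_def by (intro strict_monoI mult_strict_mono) auto
  then have lim_G: "(\<lambda>d. mon_cost t ?m (N d) / of_nat (N d)) \<longlonglongrightarrow> ?G"
    using LIMSEQ_subseq_LIMSEQ[OF G] by (simp add: o_def)
  have "q \<longlonglongrightarrow> 2"
    unfolding q_def by real_asymp
  \<comment> \<open>Here \<open>?F\<close> may be infinite: the limit 2 is neither 0 nor infinite,
    so the product is continuous there.\<close>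
  then have "(\<lambda>d. ?F * ennreal (q d)) \<longlonglongrightarrow> ?F * ennreal 2"
    by (intro tendsto_mult_ennreal tendsto_const tendsto_ennrealI) auto
  moreover have "?F * ennreal (q d) \<le> mon_cost t ?m (N d) / of_nat (N d)" if "d \<ge> 2" for d
  proof -
    define h where "h = d * (2 * d - 3)"
    have h: "h \<ge> 1" using that by (simp add: h_def)
    have "real h = real d * (2 * real d - 3)" using that by (simp add: h_def of_nat_diff)
    moreover have "real (N d) = real d * (real d + 2)" by (simp add: N_def algebra_simps)
    ultimately have q: "q d = h / N d"
      using that mult_divide_mult_cancel_left[of "real d"] by (simp only: q_def)
    have N: "N d \<ge> 1" using that by (simp add: N_def)
    have "?F * ennreal (q d) = ?F * (of_nat h / of_nat (N d))"
      using N by (simp add: q ennreal_of_nat_eq_real_of_nat divide_ennreal)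
    also have "\<dots> \<le> mon_cost t ?u h / of_nat h * (of_nat h / of_nat (N d))"
      using F[OF h] by (rule mult_right_mono) simp
    also have "\<dots> = mon_cost t ?u h / of_nat (N d)"
      using h by (simp add: ennreal_times_divide ennreal_divide_times mult_divide_eq_ennreal)
    also have "\<dots> \<le> mon_cost t ?m (N d) / of_nat (N d)"
      unfolding N_def h_def
      by (intro divide_right_mono_ennreal mon_cost_mono_target
          matmul_power_mon_restricts_unit_power that)
    finally show ?thesis .
  qed
  ultimately have "?F * ennreal 2 \<le> ?G"
    by (intro LIMSEQ_le[OF _ lim_G]) auto
  then show ?thesis by (simp add: mult.commute)
qed

theorem theorem3p4:
  fixes t :: "('i, 'j, 'k, 'a::field) tensor3"
  assumes "finite (idx1 t)" and "finite (idx2 t)" and "finite (idx3 t)"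
    and "\<not> is_simple t"
  shows "omega (unit_tensor 2 :: (nat, nat, nat, 'a) tensor3) t *
      omega_mon t (matmul_tensor 2 2 2 :: (nat \<times> nat, nat \<times> nat, nat \<times> nat, 'a) tensor3)
    \<ge> 2 * irr_mon t"
  \<comment> \<open>Moving 2 past \<open>omega\<close> leaves two products with the same first
    factor, and multiplication by it is monotone whatever its value in the extended nonnegative
    reals.\<close>
  unfolding irr_mon_def mult.left_commute[of 2]
  by (intro mult_left_mono omega_mon_matmul_ge) simp

end
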